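(* Let $k$ be a positive integer and let $G$ be a $k$-connected graph on at most $5k-2$ vertices. If $P$ and $Q$ are any two longest paths in $G$, then $|V(P)\cap V(Q)|\ge k$.
   Context: All graphs are finite and simple. A graph is $k$-connected if it has more than $k$ vertices and remains connected after deleting any set of fewer than $k$ vertices. The length of a path is its number of edges, and a longest path in $G$ is a path of maximum length among all paths in $G$. $V(P)$ denotes the vertex set of $P$. *)

theory Defs
  imports "Graph_Theory.Graph_Theory"
begin

text \<open>Finite simple graphs are rendered by the locale \<^locale>\<open>graph\<close>: finite digraphs
  with a symmetric arc relation, without loops and without parallel arcs. Each undirected edge
  is a pair of opposite arcs.\<close>

text \<open>Finiteness of the vertex set is implied: an infinite set has cardinality 0, so the first
  conjunct would fail.\<close>
definition k_connected :: "nat \<Rightarrow> ('a, 'b) pre_digraph \<Rightarrow> bool" where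
  "k_connected k G \<longleftrightarrow>
     k < card (verts G) \<and>
     (\<forall>S. S \<subseteq> verts G \<and> card S < k \<longrightarrow> Digraph_Component.connected (G \<restriction> (verts G - S)))"

text \<open>A path is given by the nonempty list of its distinct vertices in order; the same undirected
  path appears as a list and its reverse, which have the same length and vertex set.\<close>
definition longest_path :: "'a vwalk \<Rightarrow> ('a, 'b) pre_digraph \<Rightarrow> bool" where
  "longest_path P G \<longleftrightarrow> vpath P G \<and> (\<forall>R. vpath R G \<longrightarrow> vwalk_length R \<le> vwalk_length P)"

end

theory Submission
  imports Defs
begin

text \<open>Suppose that the two paths, each with \<open>L\<close> vertices, share fewer than \<open>k\<close> of them. Let \<open>H\<close> be a
  component of \<open>G - P\<close>. It has at least \<open>k\<close> neighbours on \<open>P\<close>; since \<open>P\<close> is longest, these are not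
  consecutive and not ends of \<open>P\<close>, so \<open>L \<ge> 2k\<close>. Cutting \<open>Q\<close> into \<open>k\<close> disjoint edges then shows
  that some edge of \<open>Q\<close> avoids \<open>P\<close>, so \<open>H\<close> can be chosen with at least two vertices.

  Two attachment vertices of \<open>P\<close> at distance 2 must have the same unique neighbour in \<open>H\<close>, as
  otherwise a detour through \<open>H\<close> lengthens \<open>P\<close>. Hence, if there are \<open>m\<close> attachments, \<open>b\<close> of
  them with several neighbours in \<open>H\<close>, and \<open>t\<close> vertices of \<open>H\<close> are the sole neighbour of some
  attachment, then \<open>L \<ge> 2m + b + t\<close>. If \<open>t < |H|\<close>, the \<open>b\<close> attachments and the \<open>t\<close> vertices
  separate \<open>G\<close>, so \<open>b + t \<ge> k\<close>; if \<open>t = |H|\<close>, the neighbourhoods of the vertices of \<open>H\<close> have at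
  least \<open>k\<close> elements, which makes \<open>m\<close> large. Either way \<open>L \<ge> 3k\<close>, and
  \<open>|V(G)| \<ge> 2L - (k - 1) > 5k - 2\<close>.\<close>

section \<open>Separators and vertex walks\<close>

lemma (in graph) dominates_sym: "u \<rightarrow>\<^bsub>G\<^esub> v \<Longrightarrow> v \<rightarrow>\<^bsub>G\<^esub> u"
  by (rule arcs_ends_symmetric[OF sym_arcs])

text \<open>A walk that starts in \<open>X\<close> and avoids \<open>S\<close> never leaves
  \<open>X\<close>, so deleting \<open>S\<close> cuts \<open>x\<close> off from
  \<open>w\<close>.\<close>

lemma k_connected_separator:
  fixes G :: "('a, 'b) pre_digraph"
  assumes "graph G" "k_connected k G"
    and S: "S \<subseteq> verts G" and x: "x \<in> X" "x \<in> verts G" and XS: "X \<inter> S = {}"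
    and closed: "\<And>u v. u \<in> X \<Longrightarrow> u \<rightarrow>\<^bsub>G\<^esub> v \<Longrightarrow> v \<in> X \<union> S"
    and w: "w \<in> verts G" "w \<notin> X" "w \<notin> S"
  shows "k \<le> card S"
proof (rule ccontr)
  interpret graph G by fact
  let ?G' = "G \<restriction> (verts G - S)"
  assume "\<not> k \<le> card S"
  then have "Digraph_Component.connected ?G'"
    using assms(2) S by (auto simp: k_connected_def)
  then have "x \<rightarrow>\<^sup>*\<^bsub>with_proj (mk_symmetric ?G')\<^esub> w"
    using x w XS by (auto simp: connected_def strongly_connected_def)
  then have "(x, w) \<in> (parcs (mk_symmetric ?G'))\<^sup>*"
    by (auto dest!: reachable_rtranclI)
  \<comment> \<open>Connectedness refers to the symmetric closure, where arcs may be reversed;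
    symmetry of \<open>G\<close> turns them back.\<close>
  moreover have "v \<in> X" if "u \<in> X" "(u, v) \<in> parcs (mk_symmetric ?G')" for u v
  proof -
    from that(2) have "(u, v) \<in> arcs_ends G \<or> (v, u) \<in> arcs_ends G" and "v \<notin> S"
      by (auto simp: parcs_mk_symmetric arcs_ends_conv)
    then have "u \<rightarrow>\<^bsub>G\<^esub> v"
      using dominates_sym by auto
    then show ?thesis
      using closed[OF that(1)] \<open>v \<notin> S\<close> by auto
  qed
  ultimately have "w \<in> X"
    using x(1) by (induct rule: rtrancl_induct) auto
  then show False using w by simp
qed

lemma vwalk_append:
  assumes "vwalk p G" "vwalk q G" "last p \<rightarrow>\<^bsub>G\<^esub> hd q"
  shows "vwalk (p @ q) G"
  using assms by (auto simp: vwalk_def vwalk_arcs_append)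

lemma vwalk_take_Suc: "vwalk p G \<Longrightarrow> vwalk (take (Suc i) p) G"
  by (rule vwalkI_append_l[where q="drop (Suc i) p"]) (auto simp: vwalk_def)

lemma vwalk_drop: "vwalk p G \<Longrightarrow> i < length p \<Longrightarrow> vwalk (drop i p) G"
  by (rule vwalkI_append_r[where p="take i p"]) auto

lemma vwalk_nth_dominates:
  assumes "vwalk p G" "Suc i < length p"
  shows "p ! i \<rightarrow>\<^bsub>G\<^esub> p ! Suc i"
proof -
  have "vwalk_arcs (take (Suc i) p @ drop (Suc i) p) = vwalk_arcs (take (Suc i) p) @
      (last (take (Suc i) p), hd (drop (Suc i) p)) # vwalk_arcs (drop (Suc i) p)"
    using assms(2) by (intro vwalk_arcs_append) auto
  then have "(last (take (Suc i) p), hd (drop (Suc i) p)) \<in> set (vwalk_arcs p)"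
    unfolding append_take_drop_id by (metis in_set_conv_decomp)
  moreover have "last (take (Suc i) p) = p ! i"
    using assms(2) by (simp add: take_Suc_conv_app_nth)
  moreover have "hd (drop (Suc i) p) = p ! Suc i"
    using assms(2) by (simp add: hd_drop_conv_nth)
  ultimately show ?thesis using assms(1) by (auto simp: vwalk_def)
qed

section \<open>Extremality of a longest path\<close>

lemma longest_path_length_le:
  assumes "longest_path P G" "vpath R G"
  shows "length R \<le> length P"
proof -
  have "length R - 1 \<le> length P - 1" "P \<noteq> []" "R \<noteq> []"
    using assms by (auto simp: longest_path_def vpath_def vwalk_def)
  then show ?thesis by (cases P; cases R) auto
qed

text \<open>Replacing the vertices of \<open>P\<close> strictly between positions \<open>i\<close>
  and \<open>j\<close> by \<open>W\<close> gives a path, which cannot have more vertices than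
  \<open>P\<close>.\<close>

lemma longest_path_detour:
  assumes P: "longest_path P G" and W: "vpath W G" "set W \<inter> set P = {}"
    and ij: "i < j" "j < length P"
    and arcs: "P ! i \<rightarrow>\<^bsub>G\<^esub> hd W" "last W \<rightarrow>\<^bsub>G\<^esub> P ! j"
  shows "Suc i + length W \<le> j"
proof -
  let ?R = "take (Suc i) P @ W @ drop j P"
  have vP: "vwalk P G" "distinct P" using P by (auto simp: longest_path_def vpath_def)
  have W': "vwalk W G" "W \<noteq> []" using W by (auto simp: vpath_def vwalk_def)
  have "vwalk (W @ drop j P) G"
    using W' vP ij arcs by (intro vwalk_append vwalk_drop) (auto simp: hd_drop_conv_nth)
  then have "vwalk ?R G"
    using W' vP ij arcs
    by (intro vwalk_append[of "take (Suc i) P"] vwalk_take_Suc)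
       (auto simp: take_Suc_conv_app_nth)
  moreover have "set (take (Suc i) P) \<inter> set (drop j P) = {}"
    using vP ij by (intro set_take_disj_set_drop_if_distinct) auto
  then have "distinct ?R"
    using vP W by (auto simp: vpath_def dest: in_set_takeD in_set_dropD)
  ultimately have "length ?R \<le> length P"
    by (intro longest_path_length_le[OF P] vpathI)
  then show ?thesis using ij by simp
qed

lemma longest_path_no_exit:
  assumes P: "longest_path P G" and "w \<in> verts G" "w \<notin> set P"
  shows "\<not> w \<rightarrow>\<^bsub>G\<^esub> hd P" and "\<not> last P \<rightarrow>\<^bsub>G\<^esub> w"
proof -
  have vP: "vwalk P G" "distinct P" using P by (auto simp: longest_path_def vpath_def)
  have w: "vwalk [w] G" using assms by (auto simp: vwalk_def)
  have False if "vwalk R G" "distinct R" "length R = Suc (length P)" for R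
    using longest_path_length_le[OF P vpathI[OF that(1,2)]] that(3) by simp
  note contra = this
  show "\<not> w \<rightarrow>\<^bsub>G\<^esub> hd P"
    using contra[OF vwalk_append[OF w vP(1)]] vP assms by auto
  show "\<not> last P \<rightarrow>\<^bsub>G\<^esub> w"
    using contra[OF vwalk_append[OF vP(1) w]] vP assms by auto
qed

text \<open>\<open>H\<close> is the component of \<open>x\<close> in \<open>G\<close> without
  \<open>X\<close>. Two of its vertices are joined via \<open>x\<close>, because reachability is
  symmetric there; such paths later serve as detours.\<close>

lemma (in graph) component_avoiding:
  assumes "x \<in> verts G - X"
  obtains H where "x \<in> H" "H \<subseteq> verts G - X"
    and "\<And>u v. u \<in> H \<Longrightarrow> u \<rightarrow>\<^bsub>G\<^esub> v \<Longrightarrow> v \<notin> X \<Longrightarrow> v \<in> H"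
    and "\<And>u v. u \<in> H \<Longrightarrow> v \<in> H \<Longrightarrow>
           \<exists>W. vpath W G \<and> set W \<inter> X = {} \<and> hd W = u \<and> last W = v"
proof
  let ?G' = "G \<restriction> (verts G - X)"
  interpret G': wf_digraph ?G' by (rule wellformed_induce_subgraph)
  have dom: "u \<rightarrow>\<^bsub>?G'\<^esub> v \<longleftrightarrow> u \<rightarrow>\<^bsub>G\<^esub> v \<and> u \<notin> X \<and> v \<notin> X" for u v
    by (auto simp: arcs_ends_conv)
  have "symmetric ?G'"
    unfolding symmetric_def by (intro symI) (auto simp: dom intro: dominates_sym)
  note sym = symmetric_reachable[OF this]
  let ?H = "{y. x \<rightarrow>\<^sup>*\<^bsub>?G'\<^esub> y}"
  show "x \<in> ?H" using assms by auto
  show H: "?H \<subseteq> verts G - X"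
    using G'.reachable_in_verts by auto
  show "v \<in> ?H" if "u \<in> ?H" "u \<rightarrow>\<^bsub>G\<^esub> v" "v \<notin> X" for u v
  proof -
    have "u \<rightarrow>\<^bsub>?G'\<^esub> v" using that H by (auto simp: dom)
    then show ?thesis using that(1) G'.reachable_adj_trans by auto
  qed
  show "\<exists>W. vpath W G \<and> set W \<inter> X = {} \<and> hd W = u \<and> last W = v"
    if "u \<in> ?H" "v \<in> ?H" for u v
  proof -
    have "u \<rightarrow>\<^sup>*\<^bsub>?G'\<^esub> v"
      using that sym G'.reachable_trans by blast
    then obtain W where W: "vpath W ?G'" "hd W = u" "last W = v"
      using G'.reachable_vpath_conv by auto
    have "arcs_ends ?G' \<subseteq> arcs_ends G" by (auto simp: dom)
    then have "vpath W G" "set W \<inter> X = {}"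
      using W(1) by (auto simp: vpath_def vwalk_def)
    then show ?thesis using W by auto
  qed
qed

section \<open>Counting positions along the path\<close>

lemma attachment_count:
  fixes N :: "nat \<Rightarrow> 'c set" and L :: nat
  defines "A \<equiv> {i. i < L \<and> N i \<noteq> {}}"
  assumes first: "N 0 = {}" and last: "N (L - 1) = {}"
    and adj: "\<And>i. i \<in> A \<Longrightarrow> Suc i \<notin> A"
    and gap: "\<And>i y z. i \<in> A \<Longrightarrow> Suc (Suc i) \<in> A \<Longrightarrow> y \<in> N i \<Longrightarrow> z \<in> N (Suc (Suc i)) \<Longrightarrow> y = z"
  shows "2 * card A + card {i \<in> A. \<forall>y. N i \<noteq> {y}} + card {y. \<exists>i\<in>A. N i = {y}} \<le> L"
proof -
  let ?B = "{i \<in> A. \<forall>y. N i \<noteq> {y}}" and ?T = "{y. \<exists>i\<in>A. N i = {y}}"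
  \<comment> \<open>\<open>D\<close> holds the attachments after which at least two positions are free. It contains
    \<open>?B\<close> and, for every \<open>y \<in> ?T\<close>, the last attachment whose sole neighbour is \<open>y\<close>.\<close>
  define D where "D = {i \<in> A. Suc (Suc i) \<notin> A}"
  have fin: "finite A" by (simp add: A_def)
  have range: "0 < i \<and> Suc i < L" if "i \<in> A" for i
  proof -
    have "i \<noteq> 0" "i \<noteq> L - 1" "i < L" using that first last by (auto simp: A_def)
    then show ?thesis by auto
  qed
  define g where "g y = Max {i \<in> A. N i = {y}}" for y
  have g: "g y \<in> A \<and> N (g y) = {y}" if "y \<in> ?T" for y
    using Max_in[of "{i \<in> A. N i = {y}}"] that fin by (auto simp: g_def)
  have g_max: "i \<le> g y" if "i \<in> A" "N i = {y}" for i y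
    unfolding g_def by (rule Max_ge) (use that fin in auto)
  have singleton: "\<exists>y. N i = {y} \<and> N (Suc (Suc i)) = {y}" if ii: "i \<in> A" "Suc (Suc i) \<in> A" for i
  proof -
    obtain y z where yz: "y \<in> N i" "z \<in> N (Suc (Suc i))" using ii by (auto simp: A_def)
    have "N i = {z}" using gap[OF ii _ yz(2)] yz(1) by auto
    moreover have "N (Suc (Suc i)) = {y}" using gap[OF ii yz(1)] yz(2) by auto
    ultimately show ?thesis using gap[OF ii yz] by simp
  qed
  have "?B \<subseteq> D" using singleton by (auto simp: D_def)
  moreover have "g ` ?T \<subseteq> D"
  proof
    fix i assume "i \<in> g ` ?T"
    then obtain y where y: "y \<in> ?T" "i = g y" by auto
    have False if "Suc (Suc i) \<in> A"
    proof -
      have "N (Suc (Suc i)) = {y}"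
        using singleton[of i] that g[OF y(1)] y(2) by auto
      then show False using g_max[OF that] y(2) by simp
    qed
    then show "i \<in> D" using g[OF y(1)] y(2) by (auto simp: D_def)
  qed
  moreover have disj: "?B \<inter> g ` ?T = {}"
  proof -
    have "g y \<notin> ?B" if "y \<in> ?T" for y using g[OF that] by simp
    then show ?thesis by auto
  qed
  moreover have inj: "inj_on g ?T"
  proof (rule inj_onI)
    fix y z assume yz: "y \<in> ?T" "z \<in> ?T" "g y = g z"
    have "N (g y) = {y}" "N (g z) = {z}" using g[OF yz(1)] g[OF yz(2)] by blast+
    then show "y = z" unfolding yz(3) by simp
  qed
  moreover have finD: "finite D" using fin by (simp add: D_def)
  ultimately have sub: "?B \<union> g ` ?T \<subseteq> D" and finT: "finite (g ` ?T)"
    by (simp_all add: finite_subset)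
  have "card (?B \<union> g ` ?T) = card ?B + card (g ` ?T)"
    using fin finT disj by (intro card_Un_disjoint) simp_all
  then have BT: "card ?B + card ?T \<le> card D"
    using card_mono[OF finD sub] card_image[OF inj] by simp
  \<comment> \<open>Attachments, their successors, and the second successors of members of
    \<open>D\<close> never collide. Both end positions are unattached, so indices start at 1, while
    a second successor may equal \<open>L\<close>: there are \<open>L\<close> slots.\<close>
  let ?A' = "A \<union> Suc ` A" and ?D' = "(\<lambda>i. Suc (Suc i)) ` D"
  have "?A' \<union> ?D' \<subseteq> {1..L}"
  proof
    fix j assume "j \<in> ?A' \<union> ?D'"
    then obtain i where "i \<in> A" "j \<in> {i, Suc i, Suc (Suc i)}" by (auto simp: D_def)
    then show "j \<in> {1..L}" using range[of i] by auto
  qed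
  then have "card (?A' \<union> ?D') \<le> L"
    using card_mono[of "{1..L}" "?A' \<union> ?D'"] by simp
  moreover have "card (?A' \<union> ?D') = card ?A' + card ?D'"
    using fin finD adj by (intro card_Un_disjoint) (auto simp: D_def)
  moreover have "card ?A' = card A + card (Suc ` A)"
    using fin adj by (intro card_Un_disjoint) auto
  moreover have "card (Suc ` A) = card A" "card ?D' = card D"
    by (auto intro: card_image simp: inj_on_def)
  ultimately show ?thesis using BT by simp
qed

section \<open>Attachments of a component off the path\<close>

locale off_path_component = graph G for G :: "('a, 'b) pre_digraph" +
  fixes P :: "'a vwalk" and H :: "'a set" and k :: nat
  assumes longest: "longest_path P G" and k_conn: "k_connected k G"
    and H_nonempty: "H \<noteq> {}" and H_sub: "H \<subseteq> verts G - set P"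
    and H_closed: "\<And>u v. u \<in> H \<Longrightarrow> u \<rightarrow>\<^bsub>G\<^esub> v \<Longrightarrow> v \<notin> set P \<Longrightarrow> v \<in> H"
    and H_linked: "\<And>u v. u \<in> H \<Longrightarrow> v \<in> H \<Longrightarrow>
           \<exists>W. vpath W G \<and> set W \<inter> set P = {} \<and> hd W = u \<and> last W = v"
begin

text \<open>Indexing by positions on \<open>P\<close> instead of vertices makes distance along
  \<open>P\<close> plain arithmetic.\<close>

definition nbrs :: "nat \<Rightarrow> 'a set" where
  "nbrs i = {y \<in> H. P ! i \<rightarrow>\<^bsub>G\<^esub> y}"

definition attached :: "nat set" where
  "attached = {i. i < length P \<and> nbrs i \<noteq> {}}"

definition multi :: "nat set" where
  "multi = {i \<in> attached. \<forall>y. nbrs i \<noteq> {y}}"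

definition private_nbrs :: "'a \<Rightarrow> nat set" where
  "private_nbrs y = {i \<in> attached. nbrs i = {y}}"

definition private_owners :: "'a set" where
  "private_owners = {y. \<exists>i\<in>attached. nbrs i = {y}}"

lemma P_facts: "P \<noteq> []" "set P \<subseteq> verts G" "distinct P"
  using longest by (auto simp: longest_path_def vpath_def vwalk_def)

lemma finite_H: "finite H"
  using H_sub finite_verts finite_subset by blast

lemma finite_attached: "finite attached"
  by (simp add: attached_def)

lemma nbrs_ends: "nbrs 0 = {}" "nbrs (length P - 1) = {}"
  using longest_path_no_exit[OF longest] H_sub P_facts(1)
  by (auto simp: nbrs_def hd_conv_nth last_conv_nth dest: dominates_sym)

text \<open>The detour from \<open>y\<close> to \<open>z\<close> off \<open>P\<close> has at least
  one vertex, and at distance 2 there is room for only one, which is then both \<open>y\<close> and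
  \<open>z\<close>.\<close>

lemma attached_spread:
  assumes "i < j" "j < length P" "y \<in> nbrs i" "z \<in> nbrs j"
  shows "Suc i < j" and "j = Suc (Suc i) \<Longrightarrow> y = z"
proof -
  obtain W where W: "vpath W G" "set W \<inter> set P = {}" "hd W = y" "last W = z"
    using H_linked assms by (auto simp: nbrs_def)
  have "P ! i \<rightarrow>\<^bsub>G\<^esub> hd W" "last W \<rightarrow>\<^bsub>G\<^esub> P ! j"
    using W assms dominates_sym by (auto simp: nbrs_def)
  from longest_path_detour[OF longest W(1,2) assms(1,2) this]
  have le: "Suc i + length W \<le> j" .
  moreover have ne: "W \<noteq> []" using W by (auto simp: vpath_def vwalk_def)
  ultimately show "Suc i < j" by (cases W) auto
  assume "j = Suc (Suc i)"
  then have "length W = 1" using le ne by (cases W) auto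
  then show "y = z" using W by (auto simp: length_Suc_conv)
qed

lemma attached_count: "2 * card attached + card multi + card private_owners \<le> length P"
proof -
  have "2 * card attached + card {i \<in> attached. \<forall>y. nbrs i \<noteq> {y}}
      + card {y. \<exists>i\<in>attached. nbrs i = {y}} \<le> length P"
    unfolding attached_def
  proof (rule attachment_count)
    show "nbrs 0 = {}" "nbrs (length P - 1) = {}" by (rule nbrs_ends)+
  next
    fix i assume "i \<in> {i. i < length P \<and> nbrs i \<noteq> {}}"
    then show "Suc i \<notin> {i. i < length P \<and> nbrs i \<noteq> {}}"
      using attached_spread(1)[of i "Suc i"] by auto
  next
    fix i y z
    assume "i \<in> {i. i < length P \<and> nbrs i \<noteq> {}}" "Suc (Suc i) \<in> {i. i < length P \<and> nbrs i \<noteq> {}}"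
      "y \<in> nbrs i" "z \<in> nbrs (Suc (Suc i))"
    then show "y = z" using attached_spread(2)[of i "Suc (Suc i)"] by auto
  qed
  then show ?thesis by (simp add: multi_def private_owners_def)
qed

lemma H_nbr_cases:
  assumes "u \<in> H" "u \<rightarrow>\<^bsub>G\<^esub> v"
  obtains "v \<in> H" | i where "i \<in> attached" "v = P ! i" "u \<in> nbrs i"
proof (cases "v \<in> set P")
  case True
  then obtain i where i: "i < length P" "v = P ! i" by (auto simp: in_set_conv_nth)
  then have "u \<in> nbrs i" using assms dominates_sym by (auto simp: nbrs_def)
  then show ?thesis using i that(2)[of i] by (auto simp: attached_def)
next
  case False
  then show ?thesis using H_closed assms that(1) by blast
qed

text \<open>The path vertices at positions in \<open>I\<close>, together with \<open>Y\<close>,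
  separate \<open>X\<close> from the first vertex of \<open>P\<close>, which is never
  attached.\<close>

lemma separator_bound:
  assumes X: "X \<subseteq> H" "X \<noteq> {}" and I: "I \<subseteq> attached" and Y: "Y \<subseteq> H - X"
    and cover: "\<And>u v. u \<in> X \<Longrightarrow> u \<rightarrow>\<^bsub>G\<^esub> v \<Longrightarrow> v \<in> H \<Longrightarrow> v \<in> X \<union> Y"
    and attach: "\<And>u i. u \<in> X \<Longrightarrow> i \<in> attached \<Longrightarrow> u \<in> nbrs i \<Longrightarrow> i \<in> I"
  shows "k \<le> card I + card Y"
proof -
  let ?S = "nth P ` I \<union> Y"
  have I_P: "nth P ` I \<subseteq> set P - {P ! 0}"
  proof
    fix v assume "v \<in> nth P ` I"
    then obtain i where i: "i \<in> attached" "v = P ! i" using I by auto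
    then have "i \<noteq> 0" "i < length P" using nbrs_ends by (auto simp: attached_def)
    then show "v \<in> set P - {P ! 0}"
      using i P_facts by (auto simp: nth_eq_iff_index_eq)
  qed
  obtain x where x: "x \<in> X" using X by auto
  have P0: "P ! 0 \<in> set P" using P_facts by auto
  have "k \<le> card ?S"
  proof (rule k_connected_separator[where X=X and x=x and w="P ! 0"])
    show "graph G" by unfold_locales
    show "k_connected k G" by (rule k_conn)
    show "?S \<subseteq> verts G" using I_P Y H_sub P_facts(2) by blast
    show "x \<in> verts G" "x \<in> X" using x X H_sub by auto
    show "X \<inter> ?S = {}" using I_P X(1) Y H_sub by blast
    show "P ! 0 \<in> verts G" "P ! 0 \<notin> X" "P ! 0 \<notin> ?S"
      using P0 P_facts(2) X Y I_P H_sub by blast+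
    fix u v assume uv: "u \<in> X" "u \<rightarrow>\<^bsub>G\<^esub> v"
    then have "u \<in> H" using X by auto
    then show "v \<in> X \<union> ?S"
      using uv(2) by (cases rule: H_nbr_cases) (use cover attach uv in auto)
  qed
  also have "\<dots> \<le> card (nth P ` I) + card Y" by (rule card_Un_le)
  also have "card (nth P ` I) \<le> card I"
    using I finite_attached by (intro card_image_le) (rule finite_subset)
  finally show ?thesis by simp
qed

lemma card_attached: "k \<le> card attached"
  using separator_bound[of H attached "{}"] H_nonempty by auto

lemma length_ge_double: "2 * k \<le> length P"
  using attached_count card_attached by simp

lemma length_ge_triple:
  assumes "2 \<le> card H"
  shows "3 * k \<le> length P"
proof (cases "k \<le> card multi + card private_owners")
  case True
  then show ?thesis using attached_count card_attached by simp
next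
  case False
  have "private_owners \<subseteq> H" by (auto simp: private_owners_def nbrs_def)
  moreover have "private_owners = H"
  proof (rule ccontr)
    assume "private_owners \<noteq> H"
    \<comment> \<open>A vertex of \<open>H\<close> outside \<open>private_owners\<close> meets
      \<open>P\<close> only at positions in \<open>multi\<close>.\<close>
    then have "k \<le> card multi + card private_owners"
      using \<open>private_owners \<subseteq> H\<close>
      by (intro separator_bound[of "H - private_owners"])
         (auto simp: multi_def private_owners_def)
    then show False using False by simp
  qed
  ultimately have owners: "card private_owners = card H" by simp
  \<comment> \<open>What is left of \<open>k\<close> after discounting \<open>multi\<close> and the
    other \<open>card H - 1\<close> vertices of \<open>H\<close>. The subtraction is exact, as
    \<open>card H + card multi < k\<close> in this case.\<close>
  define c where "c = Suc k - card H - card multi"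
  have k: "k = c - 1 + card H + card multi" and c: "c \<ge> 1"
    using False owners by (auto simp: c_def)
  have priv: "c \<le> card (private_nbrs y)" if "y \<in> H" for y
  proof -
    \<comment> \<open>All neighbours of \<open>y\<close> lie in \<open>H - {y}\<close> or at
      positions in \<open>multi \<union> private_nbrs y\<close>; together these isolate
      \<open>y\<close>.\<close>
    have "k \<le> card (multi \<union> private_nbrs y) + card (H - {y})"
    proof (rule separator_bound[of "{y}"])
      fix u i assume "u \<in> {y}" "i \<in> attached" "u \<in> nbrs i"
      then show "i \<in> multi \<union> private_nbrs y"
        by (auto simp: multi_def private_nbrs_def)
    qed (use that in \<open>auto simp: multi_def private_nbrs_def\<close>)
    also have "card (multi \<union> private_nbrs y) \<le> card multi + card (private_nbrs y)"
      by (rule card_Un_le)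
    finally have "k \<le> card multi + card (private_nbrs y) + card (H - {y})" by simp
    moreover have "card H = Suc (card (H - {y}))"
      using that finite_H by (rule card.remove[rotated])
    ultimately show ?thesis by (simp add: c_def)
  qed
  have fin: "finite multi" "finite (private_nbrs y)" for y
    using finite_attached by (auto simp: multi_def private_nbrs_def)
  have "card H * c \<le> (\<Sum>y\<in>H. card (private_nbrs y))"
    using sum_bounded_below[of H c "\<lambda>y. card (private_nbrs y)"] priv by simp
  also have "\<dots> = card (\<Union>y\<in>H. private_nbrs y)"
    using fin finite_H by (intro card_UN_disjoint[symmetric]) (auto simp: private_nbrs_def)
  finally have "card multi + card H * c \<le> card multi + card (\<Union>y\<in>H. private_nbrs y)"
    by simp
  also have "\<dots> = card (multi \<union> (\<Union>y\<in>H. private_nbrs y))"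
    using fin finite_H
    by (intro card_Un_disjoint[symmetric]) (auto simp: multi_def private_nbrs_def)
  also have "\<dots> \<le> card attached"
    using finite_attached by (intro card_mono) (auto simp: multi_def private_nbrs_def)
  finally have "2 * (card multi + card H * c) + card multi + card H \<le> length P"
    using attached_count owners by simp
  \<comment> \<open>What remains is \<open>(2 * card H - 3) * (c - 1) \<ge> 0\<close>.\<close>
  moreover obtain h d where "card H = h + 2" "c = d + 1"
    using assms c by (metis add.commute le_Suc_ex)
  ultimately show ?thesis using k by (simp add: algebra_simps)
qed

end

section \<open>Choosing the component and comparing sizes\<close>

lemma off_path_component_exists:
  assumes "graph G" "k_connected k G" "longest_path P G" "x \<in> verts G - set P"
  obtains H where "off_path_component G P H k" "x \<in> H"
proof -
  interpret graph G by fact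
  obtain H where "x \<in> H" "H \<subseteq> verts G - set P"
    and "\<And>u v. u \<in> H \<Longrightarrow> u \<rightarrow>\<^bsub>G\<^esub> v \<Longrightarrow> v \<notin> set P \<Longrightarrow> v \<in> H"
    and "\<And>u v. u \<in> H \<Longrightarrow> v \<in> H \<Longrightarrow>
           \<exists>W. vpath W G \<and> set W \<inter> set P = {} \<and> hd W = u \<and> last W = v"
    using component_avoiding[OF assms(4)] by metis
  then have "off_path_component G P H k"
    using assms by unfold_locales auto
  then show ?thesis using that \<open>x \<in> H\<close> by blast
qed

text \<open>Pigeonhole on the \<open>k\<close> disjoint pairs of positions \<open>2 * j\<close> and
  \<open>Suc (2 * j)\<close>: if \<open>S\<close> met each of them, it would contain
  \<open>k\<close> distinct vertices of \<open>Q\<close>.\<close>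

lemma consecutive_avoiding:
  assumes "distinct Q" "2 * k \<le> length Q" "card (S \<inter> set Q) < k"
  shows "\<exists>i. Suc i < length Q \<and> Q ! i \<notin> S \<and> Q ! Suc i \<notin> S"
proof (rule ccontr)
  assume avoiding: "\<not> ?thesis"
  have hit: "Q ! i \<in> S \<or> Q ! Suc i \<in> S" if "Suc i < length Q" for i
    using avoiding that by blast
  define f where "f j = (if Q ! (2 * j) \<in> S then 2 * j else Suc (2 * j))" for j
  have f: "f j < length Q \<and> Q ! f j \<in> S" if "j < k" for j
    using hit[of "2 * j"] that assms(2) by (auto simp: f_def)
  have "inj_on (\<lambda>j. Q ! f j) {..<k}"
  proof (rule inj_onI)
    fix i j assume "i \<in> {..<k}" "j \<in> {..<k}" "Q ! f i = Q ! f j"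
    then have "f i = f j" using f assms(1) by (auto simp: nth_eq_iff_index_eq)
    moreover have "f i div 2 = i" "f j div 2 = j" by (auto simp: f_def)
    ultimately show "i = j" by metis
  qed
  moreover have "(\<lambda>j. Q ! f j) ` {..<k} \<subseteq> S \<inter> set Q"
    using f by fastforce
  ultimately have "k \<le> card (S \<inter> set Q)"
    using card_inj_on_le[of "\<lambda>j. Q ! f j" "{..<k}" "S \<inter> set Q"] by simp
  then show False using assms(3) by simp
qed

theorem corollary1p5:
  fixes G :: "('a, 'b) pre_digraph" and k :: nat and P Q :: "'a vwalk"
  assumes "k \<ge> 1"
    and "graph G"
    and "k_connected k G"
    and "card (verts G) \<le> 5 * k - 2"
    and "longest_path P G"
    and "longest_path Q G"
  shows "card (set P \<inter> set Q) \<ge> k"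
proof (rule ccontr)
  assume "\<not> ?thesis"
  then have small: "card (set P \<inter> set Q) < k" by simp
  interpret graph G by fact
  have P: "set P \<subseteq> verts G" "distinct P" and Q: "vwalk Q G" "set Q \<subseteq> verts G" "distinct Q"
    using assms(5,6) by (auto simp: longest_path_def vpath_def vwalk_def)
  have len: "length P = length Q"
    using longest_path_length_le assms(5,6) by (metis le_antisym longest_path_def)
  \<comment> \<open>If \<open>P\<close> were Hamiltonian, so would be \<open>Q\<close>, and they
    would share more than \<open>k\<close> vertices.\<close>
  have "\<not> verts G \<subseteq> set P"
  proof
    assume "verts G \<subseteq> set P"
    then have "set P = verts G" using P by auto
    then have "card (verts G) = card (set P \<inter> set Q)"
      using Q P len distinct_card by (metis Int_absorb1 distinct_card)
    then show False using small assms(3) by (simp add: k_connected_def)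
  qed
  then obtain x where "x \<in> verts G - set P" by auto
  \<comment> \<open>This component may be a single vertex; it only yields
    \<open>2 * k \<le> length Q\<close>, which leads to a larger one.\<close>
  then obtain H\<^sub>0 where "off_path_component G P H\<^sub>0 k"
    using off_path_component_exists assms(2,3,5) by metis
  then have "2 * k \<le> length Q"
    using off_path_component.length_ge_double len by metis
  then obtain i where i: "Suc i < length Q" "Q ! i \<notin> set P" "Q ! Suc i \<notin> set P"
    using consecutive_avoiding[of Q k "set P"] Q small by auto
  have arc: "Q ! i \<rightarrow>\<^bsub>G\<^esub> Q ! Suc i" using vwalk_nth_dominates Q(1) i(1) by metis
  obtain H where H: "off_path_component G P H k" "Q ! i \<in> H"
    using off_path_component_exists[of G k P "Q ! i"] assms(2,3,5) i(2)
      subsetD[OF Q(2) nth_mem[OF Suc_lessD[OF i(1)]]] by auto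
  interpret off_path_component G P H k by (rule H)
  have "{Q ! i, Q ! Suc i} \<subseteq> H" using H_closed[OF H(2) arc i(3)] H(2) by simp
  then have "card {Q ! i, Q ! Suc i} \<le> card H" using finite_H card_mono by blast
  moreover have "Q ! i \<noteq> Q ! Suc i" using i(1) Q(3) by (simp add: nth_eq_iff_index_eq)
  ultimately have "3 * k \<le> length P" using length_ge_triple by simp
  \<comment> \<open>By inclusion-exclusion the union has at least
    \<open>6 * k - (k - 1) = 5 * k + 1\<close> vertices.\<close>
  moreover have "card (set P \<union> set Q) + card (set P \<inter> set Q) = length P + length Q"
    using card_Un_Int[of "set P" "set Q"] P Q by (simp add: distinct_card)
  moreover have "card (set P \<union> set Q) \<le> card (verts G)"
    using P Q by (intro card_mono) auto
  ultimately show False using small len assms(1,4) by simp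
qed

end
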